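(* Every regular $\mathscr{D}$-class of the endomorphism monoid of the countable universal directed graph $D$ contains $2^{\aleph_0}$ many $\mathscr{L}$-classes and $2^{\aleph_0}$ many $\mathscr{R}$-classes.
   Context: A directed graph is a pair $(V,E)$ with $E$ an irreflexive binary relation on $V$. The countable universal directed graph $D$ is the Fraïssé limit of the finite directed graphs; $\operatorname{End} D$ is its endomorphism monoid. Green's relations on a monoid $M$: $f\,\mathscr{L}\,g$ iff $Mf=Mg$; $f\,\mathscr{R}\,g$ iff $fM=gM$; $\mathscr{D}=\mathscr{L}\circ\mathscr{R}$. An element $f$ is regular if $fgf=f$ for some $g\in M$; a regular $\mathscr{D}$-class consists of regular elements. *)

theory Defs
  imports "HOL-Algebra.Coset" "HOL-Library.Equipollence" "HOL-Library.Countable_Set"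
begin

section \<open>Directed graphs and the Fraisse limit of the finite directed graphs\<close>

type_synonym 'a graph = "'a set \<times> 'a rel"

abbreviation verts :: "'a graph \<Rightarrow> 'a set" where "verts \<equiv> fst"
abbreviation edges :: "'a graph \<Rightarrow> 'a rel" where "edges \<equiv> snd"

definition directed_graph :: "'a graph \<Rightarrow> bool" where
  "directed_graph G \<longleftrightarrow> edges G \<subseteq> verts G \<times> verts G \<and> irrefl (edges G)"

definition induced :: "'a graph \<Rightarrow> 'a set \<Rightarrow> 'a graph" where
  "induced G A = (A, edges G \<inter> A \<times> A)"

definition embedding :: "('a \<Rightarrow> 'b) \<Rightarrow> 'a graph \<Rightarrow> 'b graph \<Rightarrow> bool" where
  "embedding f G H \<longleftrightarrow> f \<in> verts G \<rightarrow> verts H \<and> inj_on f (verts G) \<and>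
     (\<forall>x\<in>verts G. \<forall>y\<in>verts G. (x, y) \<in> edges G \<longleftrightarrow> (f x, f y) \<in> edges H)"

definition isomorphism :: "('a \<Rightarrow> 'b) \<Rightarrow> 'a graph \<Rightarrow> 'b graph \<Rightarrow> bool" where
  "isomorphism f G H \<longleftrightarrow> embedding f G H \<and> f ` verts G = verts H"

definition homogeneous :: "'a graph \<Rightarrow> bool" where
  "homogeneous G \<longleftrightarrow>
     (\<forall>A B f. A \<subseteq> verts G \<and> finite A \<and> B \<subseteq> verts G \<and> finite B \<and>
        isomorphism f (induced G A) (induced G B) \<longrightarrow>
        (\<exists>g. isomorphism g G G \<and> (\<forall>x\<in>A. g x = f x)))"

text \<open>Every finite graph is isomorphic to one whose vertices are natural numbers, so isomorphism-closed
  classes of finite graphs, such as the age, are represented by their members with vertices in \<^typ>\<open>nat\<close>.\<close>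

definition age :: "'a graph \<Rightarrow> nat graph set" where
  "age G = {H. finite (verts H) \<and> edges H \<subseteq> verts H \<times> verts H \<and> (\<exists>f. embedding f H G)}"

definition fraisse_limit :: "nat graph set \<Rightarrow> 'a graph \<Rightarrow> bool" where
  "fraisse_limit K G \<longleftrightarrow> countable (verts G) \<and> homogeneous G \<and> age G = K"

definition universal_directed_graph :: "'a graph \<Rightarrow> bool" where
  "universal_directed_graph G \<longleftrightarrow> directed_graph G \<and>
     fraisse_limit {H. directed_graph H \<and> finite (verts H)} G"

section \<open>The endomorphism monoid\<close>

text \<open>Endomorphisms are extensional functions, i.e. \<^const>\<open>undefined\<close> outside the vertex set, so
  that distinct elements of the carrier are distinct maps on the vertices.\<close>

definition End :: "'a graph \<Rightarrow> ('a \<Rightarrow> 'a) monoid" where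
  "End G = \<lparr>carrier = {f \<in> verts G \<rightarrow>\<^sub>E verts G. \<forall>(x, y)\<in>edges G. (f x, f y) \<in> edges G},
            monoid.mult = compose (verts G),
            one = (\<lambda>x\<in>verts G. x)\<rparr>"

lemma monoid_End:
  assumes "directed_graph G"
  shows "monoid (End G)"
proof -
  have E: "(x, y) \<in> edges G \<Longrightarrow> x \<in> verts G \<and> y \<in> verts G" for x y
    using assms unfolding directed_graph_def by blast
  have mem: "f \<in> carrier (End G) \<longleftrightarrow> f \<in> verts G \<rightarrow>\<^sub>E verts G \<and>
      (\<forall>x y. (x, y) \<in> edges G \<longrightarrow> (f x, f y) \<in> edges G)" for f
    by (simp add: End_def split_beta' Ball_def)
  have mult: "f \<otimes>\<^bsub>End G\<^esub> g = compose (verts G) f g" for f g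
    by (simp add: End_def)
  have one: "\<one>\<^bsub>End G\<^esub> = (\<lambda>x\<in>verts G. x)"
    by (simp add: End_def)
  show ?thesis
  proof (rule monoidI, unfold mult one)
    fix f g assume "f \<in> carrier (End G)" "g \<in> carrier (End G)"
    then show "compose (verts G) f g \<in> carrier (End G)"
      unfolding mem by (auto simp: compose_def dest: E)
  next
    show "(\<lambda>x\<in>verts G. x) \<in> carrier (End G)"
      unfolding mem by (auto dest: E)
  next
    fix f g h assume "h \<in> carrier (End G)"
    then show "compose (verts G) (compose (verts G) f g) h =
        compose (verts G) f (compose (verts G) g h)"
      unfolding mem by (auto simp: compose_def fun_eq_iff)
  next
    fix f assume "f \<in> carrier (End G)"
    then have f: "f \<in> verts G \<rightarrow>\<^sub>E verts G" unfolding mem by blast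
    show "compose (verts G) (\<lambda>x\<in>verts G. x) f = f"
      using f by (intro extensionalityI[of _ "verts G"]) (auto simp: compose_def PiE_def)
    show "compose (verts G) f (\<lambda>x\<in>verts G. x) = f"
      using f by (intro extensionalityI[of _ "verts G"]) (auto simp: compose_def PiE_def)
  qed
qed

section \<open>Green's relations\<close>

text \<open>Here \<^term>\<open>carrier M #>\<^bsub>M\<^esub> f\<close> is the principal left ideal \<open>M f\<close> and \<^term>\<open>f <#\<^bsub>M\<^esub> carrier M\<close> the
  principal right ideal \<open>f M\<close>.\<close>

definition green_L :: "('a, 'b) monoid_scheme \<Rightarrow> 'a rel" where
  "green_L M = {(f, g). f \<in> carrier M \<and> g \<in> carrier M \<and> carrier M #>\<^bsub>M\<^esub> f = carrier M #>\<^bsub>M\<^esub> g}"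

definition green_R :: "('a, 'b) monoid_scheme \<Rightarrow> 'a rel" where
  "green_R M = {(f, g). f \<in> carrier M \<and> g \<in> carrier M \<and> f <#\<^bsub>M\<^esub> carrier M = g <#\<^bsub>M\<^esub> carrier M}"

definition green_D :: "('a, 'b) monoid_scheme \<Rightarrow> 'a rel" where
  "green_D M = green_L M O green_R M"

definition regular_element :: "('a, 'b) monoid_scheme \<Rightarrow> 'a \<Rightarrow> bool" where
  "regular_element M f \<longleftrightarrow> f \<in> carrier M \<and> (\<exists>g\<in>carrier M. f \<otimes>\<^bsub>M\<^esub> g \<otimes>\<^bsub>M\<^esub> f = f)"

definition regular_D_class :: "('a, 'b) monoid_scheme \<Rightarrow> 'a set \<Rightarrow> bool" where
  "regular_D_class M C \<longleftrightarrow> C \<in> carrier M // green_D M \<and> (\<forall>f\<in>C. regular_element M f)"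

end

theory Submission imports Defs begin

text \<open>Any countable digraph X embeds in D so that every vertex off the image has only finitely many
  neighbours in the image. Since any finitely many vertices of D have a common neighbour, joined to
  each of them in both directions, every homomorphism from X to D then extends to an endomorphism.

  If \<open>k h = 1\<close> in a monoid, then \<open>h f\<close> is L-related and \<open>f k\<close> is R-related to \<open>f\<close>. So it suffices
  to vary \<open>h\<close> or \<open>k\<close> such that the elements \<open>h f\<close> have many images and the elements \<open>f k\<close> many
  kernels. For images, X is D with every vertex doubled: choosing one copy of each vertex gives many
  sections \<open>h\<close> of one retraction \<open>k\<close>. For kernels, X is D with infinitely many isolated vertices
  added, each of which \<open>k\<close> may send to either of two vertices separated by \<open>f\<close>.\<close>

section \<open>Homomorphisms, embeddings and homogeneity\<close>

definition graph_hom :: "('a \<Rightarrow> 'b) \<Rightarrow> 'a graph \<Rightarrow> 'b graph \<Rightarrow> bool" where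
  "graph_hom f G H \<longleftrightarrow> f \<in> verts G \<rightarrow> verts H \<and> (\<forall>(x, y)\<in>edges G. (f x, f y) \<in> edges H)"

lemma graph_homD:
  assumes "graph_hom f G H"
  shows "x \<in> verts G \<Longrightarrow> f x \<in> verts H"
    and "(x, y) \<in> edges G \<Longrightarrow> (f x, f y) \<in> edges H"
  using assms by (auto simp: graph_hom_def)

lemma graph_hom_comp: "graph_hom f G H \<Longrightarrow> graph_hom g H K \<Longrightarrow> graph_hom (g \<circ> f) G K"
  by (fastforce simp: graph_hom_def)

lemma directed_graph_edges:
  assumes "directed_graph G" "(x, y) \<in> edges G"
  shows "x \<in> verts G" "y \<in> verts G" "x \<noteq> y"
  using assms by (auto simp: directed_graph_def irrefl_def)

lemma directed_graph_irrefl: "directed_graph G \<Longrightarrow> (x, x) \<notin> edges G"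
  by (simp add: directed_graph_def irrefl_def)

lemma verts_induced [simp]: "verts (induced G A) = A"
  by (simp add: induced_def)

lemma edges_induced [simp]: "edges (induced G A) = edges G \<inter> A \<times> A"
  by (simp add: induced_def)

lemma embeddingD:
  assumes "embedding f G H"
  shows "x \<in> verts G \<Longrightarrow> f x \<in> verts H"
    and "inj_on f (verts G)"
    and "x \<in> verts G \<Longrightarrow> y \<in> verts G \<Longrightarrow> (f x, f y) \<in> edges H \<longleftrightarrow> (x, y) \<in> edges G"
  using assms by (auto simp: embedding_def)

lemma embedding_imp_graph_hom: "directed_graph G \<Longrightarrow> embedding f G H \<Longrightarrow> graph_hom f G H"
  by (auto simp: embedding_def graph_hom_def dest: directed_graph_edges)

lemma embedding_cong:
  assumes "\<And>x. x \<in> verts G \<Longrightarrow> f x = g x"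
  shows "embedding f G H \<longleftrightarrow> embedding g G H"
  using assms by (simp add: embedding_def Pi_iff cong: inj_on_cong)

lemma embedding_comp:
  assumes "embedding f G H" "embedding g H K"
  shows "embedding (g \<circ> f) G K"
  using assms by (auto simp: embedding_def Pi_iff intro!: comp_inj_on intro: inj_on_subset)

lemma embedding_induced:
  assumes "embedding f G H" "A \<subseteq> verts G"
  shows "embedding f (induced G A) H"
  using assms inj_on_subset[of f "verts G" A] by (auto simp: embedding_def)

lemma embedding_initial_segments:
  fixes c :: "'a \<Rightarrow> 'c::linorder"
  assumes c: "inj_on c A"
    and segments: "\<And>x. x \<in> A \<Longrightarrow> embedding f (induced G (insert x {y\<in>A. c y < c x})) H"
  shows "embedding f (induced G A) H"
proof -
  have "f x \<in> verts H \<and> (f x = f y \<longrightarrow> x = y) \<and> ((x, y) \<in> edges G \<longleftrightarrow> (f x, f y) \<in> edges H)"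
    if xy: "x \<in> A" "y \<in> A" for x y
  proof -
    consider "c x < c y" | "c y < c x" | "x = y"
      using inj_onD[OF c _ xy] by fastforce
    then show ?thesis
      using segments[OF xy(1)] segments[OF xy(2)] xy by cases (auto simp: embedding_def inj_on_def)
  qed
  then show ?thesis by (auto simp: embedding_def inj_on_def)
qed

lemma isomorphism_onto_image: "embedding f G H \<Longrightarrow> isomorphism f G (induced H (f ` verts G))"
  by (auto simp: isomorphism_def embedding_def)

lemma isomorphism_inv_into:
  assumes "isomorphism f G H"
  shows "isomorphism (inv_into (verts G) f) H G"
proof -
  have f: "embedding f G H" "f ` verts G = verts H"
    using assms by (auto simp: isomorphism_def)
  have inv: "inv_into (verts G) f (f x) = x" if "x \<in> verts G" for x
    using embeddingD(2)[OF f(1)] that by (rule inv_into_f_f)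
  show ?thesis
    using f(1)
    by (auto simp: isomorphism_def embedding_def inv inj_on_def image_image simp flip: f(2))
qed

lemma isomorphism_comp:
  assumes "isomorphism f G H" "isomorphism g H K"
  shows "isomorphism (g \<circ> f) G K"
  using assms embedding_comp[of f G H g K]
  by (simp add: isomorphism_def image_image[of g f "verts G", symmetric])

lemma homogeneousD:
  assumes "homogeneous G" "isomorphism f (induced G A) (induced G B)"
    and "finite A" "A \<subseteq> verts G" "finite B" "B \<subseteq> verts G"
  shows "\<exists>g. isomorphism g G G \<and> (\<forall>x\<in>A. g x = f x)"
  using assms by (simp add: homogeneous_def)

lemma homogeneous_extend_embedding:
  assumes hom: "homogeneous G" and f: "embedding f H G"
    and A: "finite A" "A \<subseteq> verts H" and i: "embedding i (induced H A) G"
  obtains g where "embedding g H G" "\<And>x. x \<in> A \<Longrightarrow> g x = i x"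
proof -
  have f_A: "embedding f (induced H A) G" using f A(2) by (rule embedding_induced)
  have "isomorphism (i \<circ> inv_into A f) (induced G (f ` A)) (induced G (i ` A))"
    using isomorphism_comp[OF isomorphism_inv_into isomorphism_onto_image[OF i]]
      isomorphism_onto_image[OF f_A] by simp
  then have "\<exists>t. isomorphism t G G \<and> (\<forall>x\<in>f ` A. t x = (i \<circ> inv_into A f) x)"
  proof (rule homogeneousD[OF hom])
    show "f ` A \<subseteq> verts G" "i ` A \<subseteq> verts G"
      using f_A i by (auto simp: embedding_def)
  qed (use A(1) in auto)
  then obtain t where t: "isomorphism t G G"
    and t_eq: "\<And>x. x \<in> f ` A \<Longrightarrow> t x = (i \<circ> inv_into A f) x"
    by blast
  show thesis
  proof
    show "embedding (t \<circ> f) H G"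
      using t by (intro embedding_comp[OF f]) (simp add: isomorphism_def)
    show "(t \<circ> f) x = i x" if "x \<in> A" for x
      using that embeddingD(2)[OF f_A] by (simp add: t_eq)
  qed
qed

section \<open>The extension property\<close>

lemma universal_directed_graph_embeds_finite:
  assumes D: "universal_directed_graph D" and H: "directed_graph H" "finite (verts H)"
  obtains f where "embedding f H D"
proof -
  define g where "g = to_nat_on (verts H)"
  define H' where "H' = (g ` verts H, map_prod g g ` edges H)"
  have g: "inj_on g (verts H)"
    using H(2) by (auto simp: g_def intro: countable_finite)
  have g_eq: "g x = g y \<longleftrightarrow> x = y" if "x \<in> verts H" "y \<in> verts H" for x y
    using g that by (rule inj_on_eq_iff)
  have edge: "(g x, g y) \<in> edges H' \<longleftrightarrow> (x, y) \<in> edges H" if "x \<in> verts H" "y \<in> verts H" for x y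
    using that directed_graph_edges[OF H(1)] by (force simp: H'_def g_eq)
  have "embedding g H H'"
    using g edge by (auto simp: embedding_def H'_def)
  moreover have "directed_graph H'"
    using directed_graph_edges[OF H(1)]
    by (fastforce simp: H'_def directed_graph_def irrefl_def g_eq)
  then have "H' \<in> age D"
    using D H(2) by (simp add: universal_directed_graph_def fraisse_limit_def H'_def)
  then obtain f where "embedding f H' D" by (auto simp: age_def)
  ultimately show thesis using that embedding_comp by blast
qed

locale extension_digraph =
  fixes D :: "'a graph"
  assumes directed: "directed_graph D"
    and countable_verts: "countable (verts D)"
    and extension: "\<lbrakk>finite A; A \<subseteq> verts D\<rbrakk> \<Longrightarrow>
      \<exists>v\<in>verts D - A. \<forall>a\<in>A. ((v, a) \<in> edges D \<longleftrightarrow> a \<in> S) \<and> ((a, v) \<in> edges D \<longleftrightarrow> a \<in> T)"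

lemma universal_directed_graph_imp_extension_digraph:
  assumes D: "universal_directed_graph D"
  shows "extension_digraph D"
proof
  show directed: "directed_graph D" and "countable (verts D)"
    using D by (auto simp: universal_directed_graph_def fraisse_limit_def)
  fix A S T :: "'a set"
  assume A: "finite A" "A \<subseteq> verts D"
  define H :: "'a option graph" where
    "H = (insert None (Some ` A),
      {(Some a, Some b) |a b. a \<in> A \<and> b \<in> A \<and> (a, b) \<in> edges D} \<union>
      {(None, Some a) |a. a \<in> A \<inter> S} \<union> {(Some a, None) |a. a \<in> A \<inter> T})"
  have "directed_graph H" "finite (verts H)"
    using A(1) directed_graph_irrefl[OF directed]
    by (auto simp: H_def directed_graph_def irrefl_def)
  then obtain f where f: "embedding f H D"
    using universal_directed_graph_embeds_finite[OF D] by blast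
  have "embedding the (induced H (Some ` A)) D"
    using A(2) by (auto simp: embedding_def inj_on_def H_def)
  moreover have "homogeneous D"
    using D by (simp add: universal_directed_graph_def fraisse_limit_def)
  moreover have "finite (Some ` A)" "Some ` A \<subseteq> verts H"
    using A(1) by (auto simp: H_def)
  ultimately obtain g where g: "embedding g H D" and "\<And>x. x \<in> Some ` A \<Longrightarrow> g x = the x"
    using homogeneous_extend_embedding[OF _ f] by blast
  then have g_Some: "g (Some a) = a" if "a \<in> A" for a using that by simp
  have None: "None \<in> verts H" and Some: "\<And>a. a \<in> A \<Longrightarrow> Some a \<in> verts H" by (auto simp: H_def)
  show "\<exists>v\<in>verts D - A. \<forall>a\<in>A. ((v, a) \<in> edges D \<longleftrightarrow> a \<in> S) \<and> ((a, v) \<in> edges D \<longleftrightarrow> a \<in> T)"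
  proof (intro bexI ballI)
    have "g None \<noteq> a" if "a \<in> A" for a
      using inj_onD[OF embeddingD(2)[OF g] _ None Some[OF that]] g_Some[OF that] by auto
    then show "g None \<in> verts D - A"
      using embeddingD(1)[OF g None] by auto
    show "((g None, a) \<in> edges D \<longleftrightarrow> a \<in> S) \<and> ((a, g None) \<in> edges D \<longleftrightarrow> a \<in> T)" if "a \<in> A" for a
      using that embeddingD(3)[OF g None Some] embeddingD(3)[OF g Some None]
      by (fastforce simp: g_Some H_def)
  qed
qed

definition has_common_neighbours :: "'a graph \<Rightarrow> bool" where
  "has_common_neighbours G \<longleftrightarrow> (\<forall>A. finite A \<and> A \<subseteq> verts G \<longrightarrow>
     (\<exists>v\<in>verts G. \<forall>a\<in>A. (v, a) \<in> edges G \<and> (a, v) \<in> edges G))"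

lemma (in extension_digraph) common_neighbours: "has_common_neighbours D"
  unfolding has_common_neighbours_def
proof (intro allI impI, elim conjE)
  fix A assume "finite A" "A \<subseteq> verts D"
  from extension[OF this, of A A]
  show "\<exists>v\<in>verts D. \<forall>a\<in>A. (v, a) \<in> edges D \<and> (a, v) \<in> edges D" by blast
qed

lemma graph_hom_infinite_image:
  assumes G: "has_common_neighbours G" and H: "directed_graph H" and f: "graph_hom f G H"
  shows "infinite (f ` verts G)"
proof
  assume "finite (f ` verts G)"
  then obtain S where S: "S \<subseteq> verts G" "finite S" "f ` verts G = f ` S"
    by (metis finite_subset_image subset_refl)
  obtain v where v: "v \<in> verts G" "\<forall>a\<in>S. (v, a) \<in> edges G \<and> (a, v) \<in> edges G"
    using G S(1,2) unfolding has_common_neighbours_def by metis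
  have "f v \<in> f ` S" using v(1) S(3) by blast
  then obtain a where a: "a \<in> S" "f v = f a" by blast
  have "(f v, f a) \<in> edges H"
    using v(2) a(1) by (intro graph_homD(2)[OF f]) blast
  then show False using directed_graph_irrefl[OF H] a(2) by simp
qed

section \<open>Extending homomorphisms from sparse sets\<close>

definition neighbours :: "'a graph \<Rightarrow> 'a \<Rightarrow> 'a set" where
  "neighbours G v = {u \<in> verts G. (u, v) \<in> edges G \<or> (v, u) \<in> edges G}"

definition sparse_set :: "'a graph \<Rightarrow> 'a set \<Rightarrow> bool" where
  "sparse_set G J \<longleftrightarrow> J \<subseteq> verts G \<and> (\<forall>v\<in>verts G - J. finite (neighbours G v \<inter> J))"

lemma dependent_measure_choice:
  fixes m :: "'a \<Rightarrow> nat"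
  assumes local: "\<And>f g x r. x \<in> S \<Longrightarrow> (\<And>y. m y < m x \<Longrightarrow> f y = g y) \<Longrightarrow> P f x r \<longleftrightarrow> P g x r"
    and step: "\<And>f x. x \<in> S \<Longrightarrow> (\<And>y. y \<in> S \<Longrightarrow> m y < m x \<Longrightarrow> P f y (f y)) \<Longrightarrow> \<exists>r. P f x r"
  obtains f where "\<And>x. x \<in> S \<Longrightarrow> P f x (f x)"
proof -
  have "\<exists>f. \<forall>x. x \<in> S \<longrightarrow> P f x (f x)"
  proof (rule dependent_wf_choice[of "measure m"])
    show "(x \<in> S \<longrightarrow> P f x r) = (x \<in> S \<longrightarrow> P g x r)"
      if "\<And>y. (y, x) \<in> measure m \<Longrightarrow> f y = g y" for f g x r
      using local[of x f g r] that by auto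
    show "\<exists>r. x \<in> S \<longrightarrow> P f x r"
      if "\<And>y. (y, x) \<in> measure m \<Longrightarrow> y \<in> S \<longrightarrow> P f y (f y)" for x f
      using step[of x f] that by auto
  qed simp
  then show thesis using that by blast
qed

lemma finite_bounded_inj_on:
  fixes c :: "'a \<Rightarrow> nat"
  assumes "inj_on c A"
  shows "finite {y\<in>A. c y < n}"
proof -
  have "{y\<in>A. c y < n} = c -` {..<n} \<inter> A" by auto
  then show ?thesis using finite_vimage_IntI[OF finite_lessThan assms] by simp
qed

context extension_digraph
begin

lemma extend_embedding_to_vertex:
  assumes X: "directed_graph X" and A: "finite A" "x \<notin> A"
    and j: "embedding j (induced X A) D" and F: "finite F" "F \<subseteq> verts D"
  obtains v where "embedding (j(x := v)) (induced X (insert x A)) D" "F \<inter> neighbours D v \<subseteq> j ` A"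
proof -
  define S T where "S = j ` {y\<in>A. (x, y) \<in> edges X}" and "T = j ` {y\<in>A. (y, x) \<in> edges X}"
  have "finite (j ` A \<union> F)" "j ` A \<union> F \<subseteq> verts D"
    using A F j by (auto simp: embedding_def)
  from extension[OF this, of S T] obtain v where v: "v \<in> verts D" "v \<notin> j ` A \<union> F"
    and v_edge: "\<And>a. a \<in> j ` A \<union> F \<Longrightarrow>
      ((v, a) \<in> edges D \<longleftrightarrow> a \<in> S) \<and> ((a, v) \<in> edges D \<longleftrightarrow> a \<in> T)"
    by blast
  have j_inj: "inj_on j A" using embeddingD(2)[OF j] by simp
  have v_j: "(v, j y) \<in> edges D \<longleftrightarrow> (x, y) \<in> edges X" "(j y, v) \<in> edges D \<longleftrightarrow> (y, x) \<in> edges X"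
    if "y \<in> A" for y
    using v_edge[of "j y"] that inj_on_eq_iff[OF j_inj] by (auto simp: S_def T_def)
  have "embedding (j(x := v)) (induced X (insert x A)) D"
    using j v A(2) v_j directed_graph_irrefl[OF X] directed_graph_irrefl[OF directed]
    by (auto simp: embedding_def inj_on_def)
  moreover have "F \<inter> neighbours D v \<subseteq> j ` A"
    using v_edge by (auto simp: neighbours_def S_def T_def)
  ultimately show thesis by (rule that)
qed

lemma exists_embedding_avoiding_neighbours:
  fixes c :: "'b \<Rightarrow> nat"
  assumes X: "directed_graph X" and c: "inj_on c (verts X)"
    and F: "\<And>x. x \<in> verts X \<Longrightarrow> finite (F x)" "\<And>x. x \<in> verts X \<Longrightarrow> F x \<subseteq> verts D"
  obtains j where "embedding j X D"
    "\<And>x. x \<in> verts X \<Longrightarrow> F x \<inter> neighbours D (j x) \<subseteq> j ` {y\<in>verts X. c y < c x}"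
proof -
  define before where "before x = {y\<in>verts X. c y < c x}" for x
  define extends where "extends j x v \<longleftrightarrow>
      embedding (j(x := v)) (induced X (insert x (before x))) D \<and>
      F x \<inter> neighbours D v \<subseteq> j ` before x" for j x v
  obtain j where j: "\<And>x. x \<in> verts X \<Longrightarrow> extends j x (j x)"
  proof (rule dependent_measure_choice[of "verts X" c extends])
    fix f g :: "'b \<Rightarrow> 'a" and x v assume "\<And>y. c y < c x \<Longrightarrow> f y = g y"
    then have eq: "f y = g y" if "y \<in> before x" for y using that by (simp add: before_def)
    then have "f ` before x = g ` before x" by (rule image_cong[OF refl])
    moreover have "embedding (f(x := v)) (induced X (insert x (before x))) D \<longleftrightarrow>
        embedding (g(x := v)) (induced X (insert x (before x))) D"
      using eq by (intro embedding_cong) auto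
    ultimately show "extends f x v \<longleftrightarrow> extends g x v" by (simp add: extends_def)
  next
    fix f x assume x: "x \<in> verts X" "\<And>y. y \<in> verts X \<Longrightarrow> c y < c x \<Longrightarrow> extends f y (f y)"
    have "finite (before x)" "x \<notin> before x"
      using finite_bounded_inj_on[OF c] by (auto simp: before_def)
    moreover have "embedding f (induced X (before x)) D"
    proof (rule embedding_initial_segments)
      show "inj_on c (before x)" using c by (auto simp: before_def intro: inj_on_subset)
      fix y assume y: "y \<in> before x"
      then have "{z\<in>before x. c z < c y} = before y" by (auto simp: before_def)
      then show "embedding f (induced X (insert y {z\<in>before x. c z < c y})) D"
        using x(2)[of y] y by (simp add: extends_def before_def)
    qed
    ultimately obtain v where "embedding (f(x := v)) (induced X (insert x (before x))) D"
      "F x \<inter> neighbours D v \<subseteq> f ` before x"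
      using F[OF x(1)] by (rule extend_embedding_to_vertex[OF X])
    then show "\<exists>v. extends f x v" by (auto simp: extends_def)
  qed blast
  then have "embedding j (induced X (verts X)) D"
    by (intro embedding_initial_segments[OF c]) (simp add: extends_def before_def)
  then have "embedding j X D" by (simp add: embedding_def)
  then show thesis using j by (intro that) (auto simp: extends_def before_def)
qed

lemma exists_sparse_embedding:
  assumes X: "directed_graph X" "countable (verts X)"
  obtains j where "embedding j X D" "sparse_set D (j ` verts X)"
proof -
  define c where "c = to_nat_on (verts X)"
  define e where "e = to_nat_on (verts D)"
  have c: "inj_on c (verts X)" and e: "inj_on e (verts D)"
    using X(2) countable_verts by (auto simp: c_def e_def)
  obtain j where j: "embedding j X D" and avoids: "\<And>x. x \<in> verts X \<Longrightarrow>
      {d\<in>verts D. e d < c x} \<inter> neighbours D (j x) \<subseteq> j ` {y\<in>verts X. c y < c x}"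
    using exists_embedding_avoiding_neighbours[OF X(1) c, of "\<lambda>x. {d\<in>verts D. e d < c x}"]
      finite_bounded_inj_on[OF e] by blast
  have "finite (neighbours D d \<inter> j ` verts X)" if d: "d \<in> verts D - j ` verts X" for d
  proof (rule finite_subset)
    have "c x \<le> e d" if x: "x \<in> verts X" "j x \<in> neighbours D d" for x
    proof (rule ccontr)
      assume "\<not> c x \<le> e d"
      then have "d \<in> j ` {y\<in>verts X. c y < c x}"
        using avoids[OF x(1)] x(2) d by (auto simp: neighbours_def)
      then show False using d by auto
    qed
    then show "neighbours D d \<inter> j ` verts X \<subseteq> j ` {x\<in>verts X. c x < Suc (e d)}"
      by (auto simp: less_Suc_eq_le)
    show "finite (j ` {x\<in>verts X. c x < Suc (e d)})"
      using finite_bounded_inj_on[OF c] by (rule finite_imageI)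
  qed
  then have "sparse_set D (j ` verts X)"
    using embeddingD(1)[OF j] by (auto simp: sparse_set_def)
  with j show thesis by (rule that)
qed

end

lemma exists_map_joining_predecessors:
  fixes m :: "'a \<Rightarrow> nat"
  assumes H: "has_common_neighbours H" and f: "f ` J \<subseteq> verts H"
    and N: "\<And>d. d \<in> V - J \<Longrightarrow> finite (N d)" "\<And>d u. u \<in> N d \<Longrightarrow> u \<in> V \<and> m u < m d"
  obtains k where "k ` V \<subseteq> verts H" "\<And>d. d \<in> V \<inter> J \<Longrightarrow> k d = f d"
    "\<And>d u. d \<in> V - J \<Longrightarrow> u \<in> N d \<Longrightarrow> (k d, k u) \<in> edges H \<and> (k u, k d) \<in> edges H"
proof -
  define admissible where "admissible k d r \<longleftrightarrow> r \<in> verts H \<and>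
      (if d \<in> J then r = f d else \<forall>u\<in>N d. (r, k u) \<in> edges H \<and> (k u, r) \<in> edges H)" for k d r
  obtain k where "\<And>d. d \<in> V \<Longrightarrow> admissible k d (k d)"
  proof (rule dependent_measure_choice[of V m admissible])
    show "admissible k d r \<longleftrightarrow> admissible k' d r" if "\<And>u. m u < m d \<Longrightarrow> k u = k' u" for k k' d r
      using that N(2) by (simp add: admissible_def)
    fix k d
    assume d: "d \<in> V" and IH: "\<And>u. u \<in> V \<Longrightarrow> m u < m d \<Longrightarrow> admissible k u (k u)"
    show "\<exists>r. admissible k d r"
    proof (cases "d \<in> J")
      case True
      then show ?thesis using f by (auto simp: admissible_def)
    next
      case False
      have "k ` N d \<subseteq> verts H" using IH N(2) by (auto simp: admissible_def)
      moreover have "finite (k ` N d)" using N(1) d False by simp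
      ultimately obtain r where "r \<in> verts H"
        "\<forall>a\<in>k ` N d. (r, a) \<in> edges H \<and> (a, r) \<in> edges H"
        using H unfolding has_common_neighbours_def by metis
      then show ?thesis using False by (auto simp: admissible_def)
    qed
  qed blast
  then show thesis by (intro that[of k]) (auto simp: admissible_def)
qed

lemma graph_hom_extends_from_sparse_set:
  assumes G: "directed_graph G" "countable (verts G)" and H: "has_common_neighbours H"
    and J: "sparse_set G J" and f: "graph_hom f (induced G J) H"
  obtains k where "graph_hom k G H" "\<And>x. x \<in> J \<Longrightarrow> k x = f x"
proof -
  define e where "e = to_nat_on (verts G)"
  have e: "inj_on e (verts G)" using G(2) by (auto simp: e_def)
  define m where "m d = (if d \<in> J then 0 else Suc (e d))" for d
  have m_0: "m d = 0 \<longleftrightarrow> d \<in> J" for d by (simp add: m_def)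
  define earlier where "earlier d = {u \<in> neighbours G d. m u < m d}" for d
  have finite_earlier: "finite (earlier d)" if d: "d \<in> verts G - J" for d
  proof (rule finite_subset)
    show "earlier d \<subseteq> (neighbours G d \<inter> J) \<union> {u\<in>verts G. e u < e d}"
      using d by (auto simp: earlier_def m_def neighbours_def split: if_splits)
    show "finite (neighbours G d \<inter> J \<union> {u\<in>verts G. e u < e d})"
      using J d finite_bounded_inj_on[OF e] by (auto simp: sparse_set_def)
  qed
  have earlier: "u \<in> verts G \<and> m u < m d" if "u \<in> earlier d" for d u
    using that by (simp add: earlier_def neighbours_def)
  have f_J: "f ` J \<subseteq> verts H" using graph_homD(1)[OF f] by auto
  obtain k where k: "k ` verts G \<subseteq> verts H" "\<And>d. d \<in> verts G \<inter> J \<Longrightarrow> k d = f d"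
    "\<And>d u. d \<in> verts G - J \<Longrightarrow> u \<in> earlier d \<Longrightarrow> (k d, k u) \<in> edges H \<and> (k u, k d) \<in> edges H"
    by (rule exists_map_joining_predecessors[OF H f_J finite_earlier earlier]) blast+
  have "(k d, k u) \<in> edges H" if edge: "(d, u) \<in> edges G" for d u
  proof -
    note du = directed_graph_edges[OF G(1) edge]
    have "m d \<noteq> m u" if "\<not> (d \<in> J \<and> u \<in> J)"
      using that du inj_onD[OF e, of d u] by (auto simp: m_def)
    then consider "d \<in> J" "u \<in> J" | "d \<notin> J" "u \<in> earlier d" | "u \<notin> J" "d \<in> earlier u"
      using du edge m_0[of d] m_0[of u] by (force simp: earlier_def neighbours_def)
    then show ?thesis
    proof cases
      case 1
      then show ?thesis using graph_homD(2)[OF f, of d u] edge du by (simp add: k(2))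
    qed (use k(3) du in auto)
  qed
  then have "graph_hom k G H" using k(1) by (auto simp: graph_hom_def)
  moreover have "k x = f x" if "x \<in> J" for x
    using k(2)[of x] that J by (auto simp: sparse_set_def)
  ultimately show thesis by (rule that)
qed

section \<open>Sections and retractions in the endomorphism monoid\<close>

lemma carrier_End_iff:
  "f \<in> carrier (End G) \<longleftrightarrow> f \<in> extensional (verts G) \<and> graph_hom f G G"
  by (auto simp: End_def graph_hom_def PiE_def)

lemma End_maps_verts: "f \<in> carrier (End G) \<Longrightarrow> x \<in> verts G \<Longrightarrow> f x \<in> verts G"
  by (auto simp: carrier_End_iff graph_hom_def)

lemma mult_End: "f \<otimes>\<^bsub>End G\<^esub> g = compose (verts G) f g"
  by (simp add: End_def)

lemma one_End: "\<one>\<^bsub>End G\<^esub> = (\<lambda>x\<in>verts G. x)"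
  by (simp add: End_def)

lemma restrict_graph_hom_in_End:
  assumes "directed_graph G" "graph_hom f G G"
  shows "restrict f (verts G) \<in> carrier (End G)"
  using assms(2) directed_graph_edges[OF assms(1)] by (auto simp: carrier_End_iff graph_hom_def)

context extension_digraph
begin

lemma exists_embedding_extending_homs:
  assumes "directed_graph X" "countable (verts X)"
  obtains j where "embedding j X D"
    "\<And>f. graph_hom f X D \<Longrightarrow> \<exists>k\<in>carrier (End D). \<forall>x\<in>verts X. k (j x) = f x"
proof -
  obtain j where j: "embedding j X D" and sparse: "sparse_set D (j ` verts X)"
    using exists_sparse_embedding[OF assms] by blast
  have "\<exists>k\<in>carrier (End D). \<forall>x\<in>verts X. k (j x) = f x" if f: "graph_hom f X D" for f
  proof -
    have inv: "inv_into (verts X) j (j x) = x" if "x \<in> verts X" for x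
      using embeddingD(2)[OF j] that by (rule inv_into_f_f)
    have "graph_hom (f \<circ> inv_into (verts X) j) (induced D (j ` verts X)) D"
      using f embeddingD(3)[OF j] by (auto simp: graph_hom_def inv)
    then obtain k where k: "graph_hom k D D"
      and kj: "\<And>d. d \<in> j ` verts X \<Longrightarrow> k d = (f \<circ> inv_into (verts X) j) d"
      using graph_hom_extends_from_sparse_set[OF directed countable_verts common_neighbours sparse]
      by blast
    have "restrict k (verts D) (j x) = f x" if "x \<in> verts X" for x
      using that embeddingD(1)[OF j] by (simp add: kj inv)
    then show ?thesis using restrict_graph_hom_in_End[OF directed k] by blast
  qed
  with j show thesis using that by blast
qed

lemma exists_section_with_free_left_inverses:
  obtains h and p :: "'i::countable \<Rightarrow> 'a" where "h \<in> carrier (End D)" "range p \<subseteq> verts D"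
    "\<And>\<phi>. range \<phi> \<subseteq> verts D \<Longrightarrow>
      \<exists>k\<in>carrier (End D). k \<otimes>\<^bsub>End D\<^esub> h = \<one>\<^bsub>End D\<^esub> \<and> (\<forall>i. k (p i) = \<phi> i)"
proof -
  define X :: "('a + 'i) graph" where
    "X = (Inl ` verts D \<union> range Inr, {(Inl x, Inl y) |x y. (x, y) \<in> edges D})"
  have X: "directed_graph X" "countable (verts X)"
    using directed countable_verts by (auto simp: X_def directed_graph_def irrefl_def)
  obtain j where j: "embedding j X D"
    and ext: "\<And>g. graph_hom g X D \<Longrightarrow> \<exists>k\<in>carrier (End D). \<forall>x\<in>verts X. k (j x) = g x"
    using exists_embedding_extending_homs[OF X] by blast
  have verts_X: "x \<in> verts D \<Longrightarrow> Inl x \<in> verts X" "Inr i \<in> verts X" for x i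
    by (auto simp: X_def)
  define h where "h = restrict (j \<circ> Inl) (verts D)"
  have "graph_hom Inl D X" by (auto simp: graph_hom_def X_def)
  then have "graph_hom (j \<circ> Inl) D D"
    using embedding_imp_graph_hom[OF X(1) j] by (rule graph_hom_comp)
  then have "h \<in> carrier (End D)"
    unfolding h_def by (rule restrict_graph_hom_in_End[OF directed])
  moreover have "range (j \<circ> Inr) \<subseteq> verts D"
    using embeddingD(1)[OF j] verts_X by auto
  moreover have "\<exists>k\<in>carrier (End D). k \<otimes>\<^bsub>End D\<^esub> h = \<one>\<^bsub>End D\<^esub> \<and> (\<forall>i. k ((j \<circ> Inr) i) = \<phi> i)"
    if "range \<phi> \<subseteq> verts D" for \<phi>
  proof -
    have "graph_hom (case_sum id \<phi>) X D"
      using that by (auto simp: graph_hom_def X_def)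
    then obtain k where "k \<in> carrier (End D)" and kj: "\<And>x. x \<in> verts X \<Longrightarrow> k (j x) = case_sum id \<phi> x"
      using ext by blast
    moreover have "k \<otimes>\<^bsub>End D\<^esub> h = \<one>\<^bsub>End D\<^esub>"
      by (auto simp: mult_End one_End compose_def h_def kj verts_X)
    ultimately show ?thesis by (auto simp: verts_X)
  qed
  ultimately show thesis by (rule that)
qed

lemma exists_retraction_with_free_sections:
  obtains k and j :: "'a \<times> 'i::countable \<Rightarrow> 'a" where
    "k \<in> carrier (End D)" "inj_on j (verts D \<times> UNIV)"
    "\<And>s. (\<lambda>x\<in>verts D. j (x, s x)) \<in> carrier (End D)"
    "\<And>s. k \<otimes>\<^bsub>End D\<^esub> (\<lambda>x\<in>verts D. j (x, s x)) = \<one>\<^bsub>End D\<^esub>"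
proof -
  define X :: "('a \<times> 'i) graph" where
    "X = (verts D \<times> UNIV, {((x, s), (y, t)) |x y s t. (x, y) \<in> edges D})"
  have X: "directed_graph X" "countable (verts X)"
    using directed countable_verts by (auto simp: X_def directed_graph_def irrefl_def)
  obtain j where j: "embedding j X D"
    and ext: "\<And>g. graph_hom g X D \<Longrightarrow> \<exists>k\<in>carrier (End D). \<forall>x\<in>verts X. k (j x) = g x"
    using exists_embedding_extending_homs[OF X] by blast
  have "graph_hom fst X D" by (auto simp: graph_hom_def X_def)
  then obtain k where k: "k \<in> carrier (End D)" and kj: "\<And>x. x \<in> verts X \<Longrightarrow> k (j x) = fst x"
    using ext by blast
  have in_End: "(\<lambda>x\<in>verts D. j (x, s x)) \<in> carrier (End D)" for s
  proof -
    have "graph_hom (\<lambda>x. (x, s x)) D X" by (auto simp: graph_hom_def X_def)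
    then have "graph_hom (j \<circ> (\<lambda>x. (x, s x))) D D"
      using embedding_imp_graph_hom[OF X(1) j] by (rule graph_hom_comp)
    from restrict_graph_hom_in_End[OF directed this] show ?thesis by (simp add: comp_def)
  qed
  have retraction: "k \<otimes>\<^bsub>End D\<^esub> (\<lambda>x\<in>verts D. j (x, s x)) = \<one>\<^bsub>End D\<^esub>" for s
    by (auto simp: mult_End one_End compose_def kj X_def)
  have "inj_on j (verts D \<times> UNIV)"
    using embeddingD(2)[OF j] by (simp add: X_def)
  with k show thesis using in_End retraction by (rule that)
qed

end

section \<open>Green's relations\<close>

lemma equiv_green_L: "equiv (carrier M) (green_L M)"
  by (auto simp: equiv_def refl_on_def sym_def trans_def green_L_def)

lemma equiv_green_R: "equiv (carrier M) (green_R M)"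
  by (auto simp: equiv_def refl_on_def sym_def trans_def green_R_def)

context monoid
begin

lemma carrier_r_coset_subset_iff:
  assumes "f \<in> carrier G" "g \<in> carrier G"
  shows "carrier G #> f \<subseteq> carrier G #> g \<longleftrightarrow> (\<exists>p\<in>carrier G. f = p \<otimes> g)"
proof
  assume "carrier G #> f \<subseteq> carrier G #> g"
  moreover have "\<one> \<otimes> f \<in> carrier G #> f" by (auto simp: r_coset_def)
  ultimately show "\<exists>p\<in>carrier G. f = p \<otimes> g" using assms by (auto simp: r_coset_def)
next
  assume "\<exists>p\<in>carrier G. f = p \<otimes> g"
  then obtain p where p: "p \<in> carrier G" "f = p \<otimes> g" by blast
  then have "h \<otimes> f = (h \<otimes> p) \<otimes> g" if "h \<in> carrier G" for h
    using assms(2) that by (simp add: m_assoc)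
  then show "carrier G #> f \<subseteq> carrier G #> g"
    using p(1) by (auto simp: r_coset_def)
qed

lemma l_coset_carrier_subset_iff:
  assumes "f \<in> carrier G" "g \<in> carrier G"
  shows "f <# carrier G \<subseteq> g <# carrier G \<longleftrightarrow> (\<exists>p\<in>carrier G. f = g \<otimes> p)"
proof
  assume "f <# carrier G \<subseteq> g <# carrier G"
  moreover have "f \<otimes> \<one> \<in> f <# carrier G" by (auto simp: l_coset_def)
  ultimately show "\<exists>p\<in>carrier G. f = g \<otimes> p" using assms by (auto simp: l_coset_def)
next
  assume "\<exists>p\<in>carrier G. f = g \<otimes> p"
  then obtain p where p: "p \<in> carrier G" "f = g \<otimes> p" by blast
  then have "f \<otimes> h = g \<otimes> (p \<otimes> h)" if "h \<in> carrier G" for h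
    using assms(2) that by (simp add: m_assoc)
  then show "f <# carrier G \<subseteq> g <# carrier G"
    using p(1) by (auto simp: l_coset_def)
qed

lemma green_L_iff:
  "(f, g) \<in> green_L G \<longleftrightarrow> f \<in> carrier G \<and> g \<in> carrier G \<and>
    (\<exists>p\<in>carrier G. f = p \<otimes> g) \<and> (\<exists>q\<in>carrier G. g = q \<otimes> f)"
  by (simp add: green_L_def set_eq_subset carrier_r_coset_subset_iff cong: conj_cong)

lemma green_R_iff:
  "(f, g) \<in> green_R G \<longleftrightarrow> f \<in> carrier G \<and> g \<in> carrier G \<and>
    (\<exists>p\<in>carrier G. f = g \<otimes> p) \<and> (\<exists>q\<in>carrier G. g = f \<otimes> q)"
  by (simp add: green_R_def set_eq_subset l_coset_carrier_subset_iff cong: conj_cong)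

lemma green_R_comp_green_L_subset_green_D: "green_R G O green_L G \<subseteq> green_D G"
proof clarify
  fix f g h assume "(f, g) \<in> green_R G" "(g, h) \<in> green_L G"
  then obtain p q r s where carr: "f \<in> carrier G" "g \<in> carrier G" "h \<in> carrier G"
      "p \<in> carrier G" "q \<in> carrier G" "r \<in> carrier G" "s \<in> carrier G"
    and eq: "f = g \<otimes> p" "g = f \<otimes> q" "g = r \<otimes> h" "h = s \<otimes> g"
    unfolding green_R_iff green_L_iff by blast
  have hp: "h \<otimes> p = s \<otimes> f"
    unfolding eq(4) using carr by (simp add: m_assoc eq(1)[symmetric])
  moreover have "f = r \<otimes> (h \<otimes> p)"
    using carr by (simp add: m_assoc[symmetric] eq(3)[symmetric] eq(1)[symmetric])
  ultimately have "(f, h \<otimes> p) \<in> green_L G"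
    unfolding green_L_iff using carr m_closed by blast
  moreover have "h = (h \<otimes> p) \<otimes> q"
    unfolding hp using carr by (simp add: m_assoc eq(2)[symmetric] eq(4)[symmetric])
  then have "(h \<otimes> p, h) \<in> green_R G"
    unfolding green_R_iff using carr m_closed by blast
  ultimately show "(f, h) \<in> green_D G" by (auto simp: green_D_def)
qed

lemma green_R_class_left_mult_subset_green_D:
  assumes "f \<in> carrier G" "h \<in> carrier G" "k \<in> carrier G" "k \<otimes> h = \<one>"
  shows "green_R G `` {h \<otimes> f} \<subseteq> green_D G `` {f}"
proof -
  have "f = k \<otimes> (h \<otimes> f)" using assms by (simp add: m_assoc[symmetric])
  then have "(f, h \<otimes> f) \<in> green_L G" using assms by (auto simp: green_L_iff)
  then show ?thesis by (auto simp: green_D_def)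
qed

lemma green_L_class_right_mult_subset_green_D:
  assumes "f \<in> carrier G" "h \<in> carrier G" "k \<in> carrier G" "k \<otimes> h = \<one>"
  shows "green_L G `` {f \<otimes> k} \<subseteq> green_D G `` {f}"
proof -
  have "f = (f \<otimes> k) \<otimes> h" using assms by (simp add: m_assoc)
  then have "(f, f \<otimes> k) \<in> green_R G" using assms by (auto simp: green_R_iff)
  then show ?thesis using green_R_comp_green_L_subset_green_D by blast
qed

end

lemma green_R_End_image_eq:
  assumes "directed_graph G" "(f, g) \<in> green_R (End G)"
  shows "f ` verts G = g ` verts G"
proof -
  interpret monoid "End G" using monoid_End[OF assms(1)] .
  have image_subset: "f ` verts G \<subseteq> g ` verts G" if fg: "(f, g) \<in> green_R (End G)" for f g
  proof -
    obtain p where p: "p \<in> carrier (End G)" and f: "f = g \<otimes>\<^bsub>End G\<^esub> p"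
      using fg unfolding green_R_iff by blast
    show ?thesis
      unfolding f using End_maps_verts[OF p] by (auto simp: mult_End compose_eq)
  qed
  have "(g, f) \<in> green_R (End G)" using assms(2) by (simp add: green_R_def)
  then show ?thesis using image_subset assms(2) by (intro subset_antisym)
qed

lemma green_L_End_kernel_eq:
  assumes "directed_graph G" "(f, g) \<in> green_L (End G)" "x \<in> verts G" "y \<in> verts G"
  shows "f x = f y \<longleftrightarrow> g x = g y"
proof -
  interpret monoid "End G" using monoid_End[OF assms(1)] .
  have kernel_subset: "f x = f y" if fg: "(f, g) \<in> green_L (End G)" and eq: "g x = g y" for f g
  proof -
    obtain p where f: "f = p \<otimes>\<^bsub>End G\<^esub> g"
      using fg unfolding green_L_iff by blast
    show ?thesis
      unfolding f using eq assms(3,4) by (simp add: mult_End compose_eq)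
  qed
  have "(g, f) \<in> green_L (End G)" using assms(2) by (simp add: green_L_def)
  then show ?thesis using kernel_subset assms(2) by blast
qed

section \<open>Counting classes\<close>

lemma quotient_lepoll: "A // r \<lesssim> A"
  unfolding proj_image[symmetric] by (rule image_lepoll)

lemma PiE_lepoll_Pow_Times: "(A \<rightarrow>\<^sub>E B) \<lesssim> Pow (A \<times> B)"
  unfolding lepoll_def
proof (intro exI conjI)
  show "inj_on (\<lambda>f. (\<lambda>x. (x, f x)) ` A) (A \<rightarrow>\<^sub>E B)"
  proof (intro inj_onI PiE_ext)
    fix f g x assume "(\<lambda>x. (x, f x)) ` A = (\<lambda>x. (x, g x)) ` A" "x \<in> A"
    then have "(x, f x) \<in> (\<lambda>x. (x, g x)) ` A" by blast
    then show "f x = g x" by auto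
  qed
qed auto

lemma Pow_countable_lepoll_continuum:
  assumes "countable A"
  shows "Pow A \<lesssim> (UNIV :: nat set set)"
  unfolding lepoll_def using inj_on_image_Pow[OF inj_on_to_nat_on[OF assms]] by blast

lemma End_classes_lepoll_continuum:
  assumes "countable (verts G)"
  shows "{K \<in> carrier (End G) // r. K \<subseteq> C} \<lesssim> (UNIV :: nat set set)"
proof -
  have "{K \<in> carrier (End G) // r. K \<subseteq> C} \<lesssim> carrier (End G) // r"
    by (auto intro: subset_imp_lepoll)
  also have "\<dots> \<lesssim> carrier (End G)" by (rule quotient_lepoll)
  also have "\<dots> \<lesssim> (verts G \<rightarrow>\<^sub>E verts G)"
    by (auto simp: End_def intro: subset_imp_lepoll)
  also have "\<dots> \<lesssim> Pow (verts G \<times> verts G)" by (rule PiE_lepoll_Pow_Times)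
  also have "\<dots> \<lesssim> (UNIV :: nat set set)"
    using assms by (intro Pow_countable_lepoll_continuum countable_SIGMA)
  finally show ?thesis .
qed

lemma UNIV_lepoll_quotient_classes:
  fixes u :: "'b \<Rightarrow> 'a"
  assumes r: "equiv A r" and u: "\<And>t. u t \<in> A" "\<And>t. r `` {u t} \<subseteq> C"
    and separated: "\<And>s t. (u s, u t) \<in> r \<Longrightarrow> s = t"
  shows "(UNIV :: 'b set) \<lesssim> {K \<in> A // r. K \<subseteq> C}"
  unfolding lepoll_def
proof (intro exI conjI)
  show "inj (\<lambda>t. r `` {u t})"
    using eq_equiv_class[OF _ r u(1)] separated by (auto intro!: injI)
  show "range (\<lambda>t. r `` {u t}) \<subseteq> {K \<in> A // r. K \<subseteq> C}"
    using u by (auto intro: quotientI)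
qed

context extension_digraph
begin

sublocale End: monoid "End D"
  using directed by (rule monoid_End)

lemma infinite_image_End: "f \<in> carrier (End D) \<Longrightarrow> infinite (f ` verts D)"
  using graph_hom_infinite_image[OF common_neighbours directed] by (simp add: carrier_End_iff)

lemma continuum_lepoll_green_L_classes:
  assumes f: "f \<in> carrier (End D)"
  shows "(UNIV :: nat set set) \<lesssim>
    {K \<in> carrier (End D) // green_L (End D). K \<subseteq> green_D (End D) `` {f}}"
proof -
  have "\<not> f ` verts D \<subseteq> {y}" for y
    using infinite_image_End[OF f] finite_subset by blast
  then obtain a b where ab: "a \<in> verts D" "b \<in> verts D" "f a \<noteq> f b"
    by (metis image_subsetI singletonI)
  obtain h and p :: "nat \<Rightarrow> 'a" where h: "h \<in> carrier (End D)" and p: "range p \<subseteq> verts D"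
    and left_inverse: "\<And>\<phi>. range \<phi> \<subseteq> verts D \<Longrightarrow>
      \<exists>k\<in>carrier (End D). k \<otimes>\<^bsub>End D\<^esub> h = \<one>\<^bsub>End D\<^esub> \<and> (\<forall>i. k (p i) = \<phi> i)"
    by (fact exists_section_with_free_left_inverses)
  have "\<exists>k\<in>carrier (End D). k \<otimes>\<^bsub>End D\<^esub> h = \<one>\<^bsub>End D\<^esub> \<and>
      (\<forall>i. k (p i) = (if i \<in> T then a else b))" for T
    using ab by (intro left_inverse) auto
  then obtain k where k: "\<And>T. k T \<in> carrier (End D)" "\<And>T. k T \<otimes>\<^bsub>End D\<^esub> h = \<one>\<^bsub>End D\<^esub>"
    and kp: "\<And>T i. k T (p i) = (if i \<in> T then a else b)"
    by metis
  have kh: "k T (h a) = a" for T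
    using fun_cong[OF k(2)[of T], of a] ab by (simp add: mult_End one_End compose_eq)
  have kernel: "i \<in> T \<longleftrightarrow> (f \<otimes>\<^bsub>End D\<^esub> k T) (p i) = (f \<otimes>\<^bsub>End D\<^esub> k T) (h a)" for i T
    using ab p End_maps_verts[OF h] by (auto simp: mult_End compose_eq kp kh range_subsetD)
  show ?thesis
  proof (rule UNIV_lepoll_quotient_classes[OF equiv_green_L])
    show "f \<otimes>\<^bsub>End D\<^esub> k T \<in> carrier (End D)" for T using f k by simp
    show "green_L (End D) `` {f \<otimes>\<^bsub>End D\<^esub> k T} \<subseteq> green_D (End D) `` {f}" for T
      using End.green_L_class_right_mult_subset_green_D[OF f h k] .
    fix S T assume "(f \<otimes>\<^bsub>End D\<^esub> k S, f \<otimes>\<^bsub>End D\<^esub> k T) \<in> green_L (End D)"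
    from green_L_End_kernel_eq[OF directed this range_subsetD[OF p] End_maps_verts[OF h ab(1)]]
    show "S = T" using kernel by blast
  qed
qed

lemma continuum_lepoll_green_R_classes:
  assumes f: "f \<in> carrier (End D)"
  shows "(UNIV :: nat set set) \<lesssim>
    {K \<in> carrier (End D) // green_R (End D). K \<subseteq> green_D (End D) `` {f}}"
proof -
  obtain c :: "nat \<Rightarrow> 'a" where c: "inj c" "range c \<subseteq> f ` verts D"
    using infinite_countable_subset[OF infinite_image_End[OF f]] by blast
  obtain k and j :: "'a \<times> bool \<Rightarrow> 'a" where k: "k \<in> carrier (End D)"
    and j: "inj_on j (verts D \<times> UNIV)"
    and sections: "\<And>s. (\<lambda>x\<in>verts D. j (x, s x)) \<in> carrier (End D)"
      "\<And>s. k \<otimes>\<^bsub>End D\<^esub> (\<lambda>x\<in>verts D. j (x, s x)) = \<one>\<^bsub>End D\<^esub>"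
    by (fact exists_retraction_with_free_sections)
  define h where "h T = (\<lambda>x\<in>verts D. j (x, x \<in> c ` T))" for T
  have h: "h T \<in> carrier (End D)" "k \<otimes>\<^bsub>End D\<^esub> h T = \<one>\<^bsub>End D\<^esub>" for T
    unfolding h_def by (rule sections)+
  have image: "i \<in> T \<longleftrightarrow> j (c i, True) \<in> (h T \<otimes>\<^bsub>End D\<^esub> f) ` verts D" for i T
  proof -
    obtain x where x: "x \<in> verts D" "c i = f x" using c(2) by blast
    have "j (c i, True) \<in> (h T \<otimes>\<^bsub>End D\<^esub> f) ` verts D \<longleftrightarrow> c i \<in> c ` T"
      using x End_maps_verts[OF f]
      by (auto simp: mult_End compose_eq h_def image_iff inj_on_eq_iff[OF j])
    then show ?thesis using c(1) by (simp add: inj_image_mem_iff)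
  qed
  show ?thesis
  proof (rule UNIV_lepoll_quotient_classes[OF equiv_green_R])
    show "h T \<otimes>\<^bsub>End D\<^esub> f \<in> carrier (End D)" for T using f h by simp
    show "green_R (End D) `` {h T \<otimes>\<^bsub>End D\<^esub> f} \<subseteq> green_D (End D) `` {f}" for T
      using End.green_R_class_left_mult_subset_green_D[OF f h(1) k h(2)] .
    fix S T assume "(h S \<otimes>\<^bsub>End D\<^esub> f, h T \<otimes>\<^bsub>End D\<^esub> f) \<in> green_R (End D)"
    then have "(h S \<otimes>\<^bsub>End D\<^esub> f) ` verts D = (h T \<otimes>\<^bsub>End D\<^esub> f) ` verts D"
      by (rule green_R_End_image_eq[OF directed])
    then show "S = T" by (simp add: set_eq_iff[of S T] image)
  qed
qed

end

theorem theorem4p6: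
  fixes D :: "'a graph" and C :: "('a \<Rightarrow> 'a) set"
  assumes "universal_directed_graph D"
    and "regular_D_class (End D) C"
  shows "{K \<in> carrier (End D) // green_L (End D). K \<subseteq> C} \<approx> (UNIV :: nat set set) \<and>
         {K \<in> carrier (End D) // green_R (End D). K \<subseteq> C} \<approx> (UNIV :: nat set set)"
proof -
  interpret extension_digraph D
    using assms(1) by (rule universal_directed_graph_imp_extension_digraph)
  obtain f where f: "f \<in> carrier (End D)" and C: "C = green_D (End D) `` {f}"
    using assms(2) by (auto simp: regular_D_class_def elim: quotientE)
  show ?thesis
    unfolding C
    using End_classes_lepoll_continuum[OF countable_verts]
      continuum_lepoll_green_L_classes[OF f] continuum_lepoll_green_R_classes[OF f]
    by (blast intro: lepoll_antisym)
qed

end
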